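(* Let $F$ be an oriented surface, let $\Delta:\mathbb Z[\hat\pi]\to\mathbb Z[\hat\pi]\otimes_{\mathbb Z}\mathbb Z[\hat\pi]$ be the Turaev cobracket, let $\mu:\mathbb Z[\hat\pi]\to E$ be the operation defined in the context, and let $Q:E\to\mathbb Z[\hat\pi]\otimes_{\mathbb Z}\mathbb Z[\hat\pi]$ be the linear map which smooths a chord diagram according to its orientation at the image of its chord and tensors the two resulting free homotopy classes, i.e. $Q([\phi\bullet_p\psi])=[\phi]\otimes[\psi]$. Then $\Delta=Q\circ\mu$; that is, the Turaev cobracket factors through $\mu$.
   Context: Conventions: everything is smooth ($C^\infty$). $\hat\pi=\hat\pi(F)$ is the set of free homotopy classes of loops $S^1\to F$ and $\mathbb Z[\hat\pi]$ is the free $\mathbb Z$-module on $\hat\pi$. Self-intersection points: for a loop $a:S^1\to F$ in general position (transverse self-intersections), $\mathcal{SI}=\{(t_1,t_2)\in (S^1\times S^1-\mathbb D)/\mathbb Z_2 : a(t_1)=a(t_2)\}$, where $\mathbb D$ is the diagonal and $\mathbb Z_2$ interchanges the coordinates. For $(t_1,t_2)\in\mathcal{SI}$ and $p=a(t_1)=a(t_2)$, let $[t_1,t_2]$ and $[t_2,t_1]$ be the two arcs of $S^1$ running from one point to the other in the direction of the orientation of $S^1$. The loops $a([t_1,t_2])$ and $a([t_2,t_1])$ based at $p$ are named $a^1_p$ and $a^2_p$ so that the ordered pair of their initial tangent vectors at $p$ gives the orientation of $T_pF$. $\mathcal{SI}_0\subset\mathcal{SI}$ is the subset of points for which both $a^1_p$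 and $a^2_p$ are nontrivial in $\pi_1(F,p)$. The Turaev cobracket is the linear map given, for $\alpha\in\hat\pi$ and any representative $a$ of $\alpha$ in general position, by $\Delta(\alpha)=\sum_{(t_1,t_2)\in\mathcal{SI}_0}\big([a^1_p]\otimes[a^2_p]-[a^2_p]\otimes[a^1_p]\big)$, where $[\cdot]$ denotes the free homotopy class of a loop; it is independent of the choice of $a$. Chord diagrams: a geometrical chord diagram with one core circle and one oriented chord is a map to $F$ from the union of an oriented circle and an oriented arc (the chord) joining two distinct points of the circle, such that the chord is mapped to a point. $[\cdot]$ denotes its homotopy class (through such maps, with underlying chord diagrams identified up to isomorphism respecting the orientations of circle and chord). $E$ is the free $\mathbb Z$-module generated by these classes. For loops $\phi,\psi$ based at $p$, $\phi\bullet_p\psi$ is the geometrical chord diagram with core circle $I/\partial I$, $I=[0,1]$, and one chord with head at $0$ and tail at $\tfrac12$, mapped to $p$, with restriction $\phi$ on $[0,\tfrac12]$ and $\psi$ on $[\tfrac12,1]$ (each reparametrized). Every generator of $E$ is of this form. The map $\mu:\mathbb Z[\hat\pi]\to E$ is the linear map given, for $\alpha\in\hat\pi$ and any representative $a$ of $\alpha$ in general position, by $\mu(\alpha)=\sum_{(t_1,t_2)\in\mathcal{SI}_0}\big([a^1_p\bullet_p a^2_p]-[a^2_p\bullet_p a^1_p]\big)$; it is independent of the choice of $a$. *)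

theory Defs
  imports "HOL-Analysis.Analysis" "HOL-Algebra.Algebra"
begin

section \<open>Smooth maps and oriented smooth surfaces\<close>

text \<open>On an open set of a Euclidean space this is ordinary \<open>C\<^sup>k\<close>-regularity.\<close>

primrec Ck_on_open :: "nat \<Rightarrow> ('b::real_normed_vector \<Rightarrow> 'c::real_normed_vector) \<Rightarrow> 'b set \<Rightarrow> bool" where
  "Ck_on_open 0 f W = continuous_on W f"
| "Ck_on_open (Suc k) f W =
     (f differentiable_on W \<and> (\<forall>v. Ck_on_open k (\<lambda>x. frechet_derivative f (at x) v) W))"

text \<open>The set \<open>S\<close> need not be open (charts of a surface with boundary), so smoothness means
  local extendability to a smooth map on an open set.\<close>

definition smooth_map_on :: "'b::real_normed_vector set \<Rightarrow> ('b \<Rightarrow> 'c::real_normed_vector) \<Rightarrow> bool" where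
  "smooth_map_on S f \<longleftrightarrow>
     (\<forall>x\<in>S. \<exists>W g. open W \<and> x \<in> W \<and> (\<forall>k. Ck_on_open k g W) \<and> (\<forall>y\<in>S \<inter> W. g y = f y))"

definition half_plane :: "(real^2) set" where
  "half_plane = {x. 0 \<le> x $ 2}"

definition is_chart :: "'a::topological_space set \<Rightarrow> 'a set \<Rightarrow> ('a \<Rightarrow> real^2) \<Rightarrow> bool" where
  "is_chart F U \<phi> \<longleftrightarrow>
     openin (top_of_set F) U \<and>
     (open (\<phi> ` U) \<or> openin (top_of_set half_plane) (\<phi> ` U)) \<and>
     (\<exists>\<phi>'. homeomorphism U (\<phi> ` U) \<phi> \<phi>')"

definition transition :: "'a set \<Rightarrow> ('a \<Rightarrow> real^2) \<Rightarrow> ('a \<Rightarrow> real^2) \<Rightarrow> real^2 \<Rightarrow> real^2" where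
  "transition U \<phi> \<psi> = \<psi> \<circ> the_inv_into U \<phi>"

definition oriented_transition ::
  "'a set \<times> ('a \<Rightarrow> real^2) \<Rightarrow> 'a set \<times> ('a \<Rightarrow> real^2) \<Rightarrow> bool" where
  "oriented_transition c d \<longleftrightarrow>
     (case (c, d) of ((U, \<phi>), (V, \<psi>)) \<Rightarrow>
        smooth_map_on (\<phi> ` (U \<inter> V)) (transition U \<phi> \<psi>) \<and>
        (\<forall>x\<in>\<phi> ` (U \<inter> V). \<exists>D.
           (transition U \<phi> \<psi> has_derivative D) (at x within \<phi> ` (U \<inter> V)) \<and> 0 < det (matrix D)))"

text \<open>The surface is the subspace \<open>F\<close>, possibly with boundary, non-compact or disconnected.
  Its smooth structure and its orientation are given by the oriented atlas \<open>A\<close>.\<close>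

definition oriented_surface ::
  "'a::topological_space set \<Rightarrow> ('a set \<times> ('a \<Rightarrow> real^2)) set \<Rightarrow> bool" where
  "oriented_surface F A \<longleftrightarrow>
     Hausdorff_space (top_of_set F) \<and> second_countable (top_of_set F) \<and>
     (\<forall>(U, \<phi>)\<in>A. is_chart F U \<phi>) \<and> (\<Union>(U, \<phi>)\<in>A. U) = F \<and>
     (\<forall>c\<in>A. \<forall>d\<in>A. oriented_transition c d)"


section \<open>Loops and free homotopy classes\<close>

text \<open>The circle is \<open>I/\<partial>I\<close>, with the orientation of \<open>I = [0,1]\<close>. A map from the circle is a closed path
  on \<open>{0..1}\<close>; \<open>circle_map a\<close> is its lift to the universal cover of the circle. Points of the circle
  are represented by numbers in \<open>{0..<1}\<close>.\<close>

definition free_loops :: "'a::topological_space set \<Rightarrow> (real \<Rightarrow> 'a) set" where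
  "free_loops F = {a. path a \<and> path_image a \<subseteq> F \<and> pathfinish a = pathstart a}"

definition circle_map :: "(real \<Rightarrow> 'a) \<Rightarrow> real \<Rightarrow> 'a" where
  "circle_map a = (\<lambda>t. a (frac t))"

definition free_class :: "'a::topological_space set \<Rightarrow> (real \<Rightarrow> 'a) \<Rightarrow> (real \<Rightarrow> 'a) set" where
  "free_class F a = {b. homotopic_loops F a b}"

definition pi_hat :: "'a::topological_space set \<Rightarrow> (real \<Rightarrow> 'a) set set" where
  "pi_hat F = free_class F ` free_loops F"

definition null_homotopic_loop :: "'a::topological_space set \<Rightarrow> (real \<Rightarrow> 'a) \<Rightarrow> bool" where
  "null_homotopic_loop F a \<longleftrightarrow> homotopic_paths F a (\<lambda>_. pathstart a)"

text \<open>The restriction of \<open>a\<close> to the arc \<open>[s,t]\<close> of the circle, run through in the direction of the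
  orientation; its length is \<open>frac (t - s)\<close>, also if the arc passes through the point \<open>0\<close>.\<close>

definition arc_loop :: "(real \<Rightarrow> 'a) \<Rightarrow> real \<Rightarrow> real \<Rightarrow> real \<Rightarrow> 'a" where
  "arc_loop a s t = (\<lambda>x. circle_map a (s + x * frac (t - s)))"


section \<open>General position and self-intersections\<close>

definition velocity :: "('a \<Rightarrow> real^2) \<Rightarrow> (real \<Rightarrow> 'a) \<Rightarrow> real \<Rightarrow> real^2" where
  "velocity \<phi> a t = vector_derivative (\<phi> \<circ> circle_map a) (at t)"

definition velocity_det :: "('a \<Rightarrow> real^2) \<Rightarrow> (real \<Rightarrow> 'a) \<Rightarrow> real \<Rightarrow> real \<Rightarrow> real" where
  "velocity_det \<phi> a s t = det (vector [velocity \<phi> a s, velocity \<phi> a t] :: real^2^2)"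

text \<open>An unordered pair of distinct points of the circle is represented by the pair \<open>(s, t)\<close> with
  \<open>s < t\<close>.\<close>

definition self_intersections :: "(real \<Rightarrow> 'a) \<Rightarrow> (real \<times> real) set" where
  "self_intersections a = {(s, t). 0 \<le> s \<and> s < t \<and> t < 1 \<and> a s = a t}"

definition general_position ::
  "('a set \<times> ('a \<Rightarrow> real^2)) set \<Rightarrow> (real \<Rightarrow> 'a) \<Rightarrow> bool" where
  "general_position A a \<longleftrightarrow>
     (\<forall>(U, \<phi>)\<in>A.
        smooth_map_on {t. circle_map a t \<in> U} (\<phi> \<circ> circle_map a) \<and>
        (\<forall>t. circle_map a t \<in> U \<longrightarrow> velocity \<phi> a t \<noteq> 0) \<and>
        (\<forall>(s, t)\<in>self_intersections a. a s \<in> U \<longrightarrow> velocity_det \<phi> a s t \<noteq> 0))"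

definition essential_self_intersections ::
  "'a::topological_space set \<Rightarrow> (real \<Rightarrow> 'a) \<Rightarrow> (real \<times> real) set" where
  "essential_self_intersections F a =
     {(s, t) \<in> self_intersections a.
        \<not> null_homotopic_loop F (arc_loop a s t) \<and> \<not> null_homotopic_loop F (arc_loop a t s)}"

text \<open>The loops \<open>a([s,t])\<close> and \<open>a([t,s])\<close> have initial tangent vectors \<open>a'(s)\<close> and \<open>a'(t)\<close>. The sign of
  their determinant does not depend on the chart of the oriented atlas.\<close>

definition positively_ordered ::
  "('a set \<times> ('a \<Rightarrow> real^2)) set \<Rightarrow> (real \<Rightarrow> 'a) \<Rightarrow> real \<times> real \<Rightarrow> bool" where
  "positively_ordered A a p \<longleftrightarrow>
     (case p of (s, t) \<Rightarrow> \<exists>(U, \<phi>)\<in>A. a s \<in> U \<and> 0 < velocity_det \<phi> a s t)"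

definition first_loop ::
  "('a set \<times> ('a \<Rightarrow> real^2)) set \<Rightarrow> (real \<Rightarrow> 'a) \<Rightarrow> real \<times> real \<Rightarrow> real \<Rightarrow> 'a" where
  "first_loop A a p = (case p of (s, t) \<Rightarrow>
     if positively_ordered A a (s, t) then arc_loop a s t else arc_loop a t s)"

definition second_loop ::
  "('a set \<times> ('a \<Rightarrow> real^2)) set \<Rightarrow> (real \<Rightarrow> 'a) \<Rightarrow> real \<times> real \<Rightarrow> real \<Rightarrow> 'a" where
  "second_loop A a p = (case p of (s, t) \<Rightarrow>
     if positively_ordered A a (s, t) then arc_loop a t s else arc_loop a s t)"

definition generic_representative ::
  "('a set \<times> ('a \<Rightarrow> real^2)) set \<Rightarrow> (real \<Rightarrow> 'a) set \<Rightarrow> real \<Rightarrow> 'a" where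
  "generic_representative A \<alpha> = (SOME a. a \<in> \<alpha> \<and> general_position A a)"


section \<open>Tensor products and linear maps\<close>

text \<open>Abelian groups (\<open>\<int>\<close>-modules) are written multiplicatively.\<close>

definition tensor_relations ::
  "('b, 'm) monoid_scheme \<Rightarrow> ('c, 'n) monoid_scheme \<Rightarrow> ('b \<times> 'c \<Rightarrow>\<^sub>0 int) set" where
  "tensor_relations G H =
     {frag_of (x \<otimes>\<^bsub>G\<^esub> x', y) - frag_of (x, y) - frag_of (x', y) | x x' y.
        x \<in> carrier G \<and> x' \<in> carrier G \<and> y \<in> carrier H} \<union>
     {frag_of (x, y \<otimes>\<^bsub>H\<^esub> y') - frag_of (x, y) - frag_of (x, y') | x y y'.
        x \<in> carrier G \<and> y \<in> carrier H \<and> y' \<in> carrier H}"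

definition tensor_subgroup ::
  "('b, 'm) monoid_scheme \<Rightarrow> ('c, 'n) monoid_scheme \<Rightarrow> ('b \<times> 'c \<Rightarrow>\<^sub>0 int) set" where
  "tensor_subgroup G H =
     generate (free_Abelian_group (carrier G \<times> carrier H)) (tensor_relations G H)"

definition tensor_product ::
  "('b, 'm) monoid_scheme \<Rightarrow> ('c, 'n) monoid_scheme \<Rightarrow> ('b \<times> 'c \<Rightarrow>\<^sub>0 int) set monoid" where
  "tensor_product G H = free_Abelian_group (carrier G \<times> carrier H) Mod tensor_subgroup G H"

definition elementary_tensor ::
  "('b, 'm) monoid_scheme \<Rightarrow> ('c, 'n) monoid_scheme \<Rightarrow> 'b \<Rightarrow> 'c \<Rightarrow> ('b \<times> 'c \<Rightarrow>\<^sub>0 int) set" where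
  "elementary_tensor G H x y =
     tensor_subgroup G H #>\<^bsub>free_Abelian_group (carrier G \<times> carrier H)\<^esub> frag_of (x, y)"

text \<open>The linear map from a free abelian group to \<open>G\<close> with values \<open>b\<close> on the basis. If \<open>G\<close> is itself a
  free abelian group, this is \<open>frag_extend\<close>.\<close>

definition linear_extension :: "('c, 'm) monoid_scheme \<Rightarrow> ('b \<Rightarrow> 'c) \<Rightarrow> ('b \<Rightarrow>\<^sub>0 int) \<Rightarrow> 'c" where
  "linear_extension G b x =
     finprod G (\<lambda>i. b i [^]\<^bsub>G\<^esub> poly_mapping.lookup x i) (Poly_Mapping.keys x)"

abbreviation loop_module ::
  "'a::topological_space set \<Rightarrow> ((real \<Rightarrow> 'a) set \<Rightarrow>\<^sub>0 int) monoid" where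
  "loop_module F \<equiv> free_Abelian_group (pi_hat F)"

abbreviation loop_tensor where
  "loop_tensor F \<equiv> tensor_product (loop_module F) (loop_module F)"

definition class_tensor ::
  "'a::topological_space set \<Rightarrow> (real \<Rightarrow> 'a) \<Rightarrow> (real \<Rightarrow> 'a) \<Rightarrow>
     (((real \<Rightarrow> 'a) set \<Rightarrow>\<^sub>0 int) \<times> ((real \<Rightarrow> 'a) set \<Rightarrow>\<^sub>0 int) \<Rightarrow>\<^sub>0 int) set" where
  "class_tensor F a b =
     elementary_tensor (loop_module F) (loop_module F)
       (frag_of (free_class F a)) (frag_of (free_class F b))"


section \<open>The Turaev cobracket\<close>

text \<open>By transversality every class in \<open>pi_hat F\<close> contains a loop in general position, so the
  fallback values \<open>\<one>\<close> here and \<open>0\<close> in \<open>mu_class\<close> are never used; and neither sum depends on the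
  loop chosen in the class.\<close>

definition cobracket_of_loop where
  "cobracket_of_loop F A a =
     finprod (loop_tensor F)
       (\<lambda>p. class_tensor F (first_loop A a p) (second_loop A a p) \<otimes>\<^bsub>loop_tensor F\<^esub>
            inv\<^bsub>loop_tensor F\<^esub> class_tensor F (second_loop A a p) (first_loop A a p))
       (essential_self_intersections F a)"

definition cobracket_class where
  "cobracket_class F A \<alpha> =
     (if \<exists>a\<in>\<alpha>. general_position A a
      then cobracket_of_loop F A (generic_representative A \<alpha>)
      else \<one>\<^bsub>loop_tensor F\<^esub>)"

definition turaev_cobracket where
  "turaev_cobracket F A = linear_extension (loop_tensor F) (cobracket_class F A)"


section \<open>Chord diagrams and the operation \<open>\<mu>\<close>\<close>

text \<open>A geometrical chord diagram \<open>(f, h, t)\<close> consists of the map \<open>f\<close> on the core circle and of the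
  head \<open>h\<close> and the tail \<open>t\<close> of the chord.\<close>

type_synonym 'a chord_diagram = "(real \<Rightarrow> 'a) \<times> real \<times> real"

definition chord_diagrams :: "'a::topological_space set \<Rightarrow> 'a chord_diagram set" where
  "chord_diagrams F =
     {(f, h, t). f \<in> free_loops F \<and> h \<in> {0..<1} \<and> t \<in> {0..<1} \<and> h \<noteq> t \<and> f h = f t}"

text \<open>Lifts of the orientation-preserving homeomorphisms of the circle.\<close>

definition circle_homeo_lift :: "(real \<Rightarrow> real) \<Rightarrow> bool" where
  "circle_homeo_lift \<theta> \<longleftrightarrow>
     continuous_on UNIV \<theta> \<and> strict_mono \<theta> \<and> (\<forall>x. \<theta> (x + 1) = \<theta> x + 1)"

definition chord_homotopic ::
  "'a::topological_space set \<Rightarrow> 'a chord_diagram \<Rightarrow> 'a chord_diagram \<Rightarrow> bool" where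
  "chord_homotopic F D D' \<longleftrightarrow>
     D \<in> chord_diagrams F \<and> D' \<in> chord_diagrams F \<and>
     (case (D, D') of ((f, h, t), (f', h', t')) \<Rightarrow>
        \<exists>\<theta>. circle_homeo_lift \<theta> \<and> frac (\<theta> h) = h' \<and> frac (\<theta> t) = t' \<and>
            homotopic_with_canon (\<lambda>r. pathfinish r = pathstart r \<and> r h = r t) {0..1} F
              f (circle_map f' \<circ> \<theta>))"

definition chord_class :: "'a::topological_space set \<Rightarrow> 'a chord_diagram \<Rightarrow> 'a chord_diagram set" where
  "chord_class F D = {D'. chord_homotopic F D D'}"

abbreviation chord_module ::
  "'a::topological_space set \<Rightarrow> ('a chord_diagram set \<Rightarrow>\<^sub>0 int) monoid" where
  "chord_module F \<equiv> free_Abelian_group (chord_class F ` chord_diagrams F)"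

definition bullet ::
  "(real \<Rightarrow> 'a::topological_space) \<Rightarrow> (real \<Rightarrow> 'a) \<Rightarrow> 'a chord_diagram" where
  "bullet \<phi> \<psi> = (\<phi> +++ \<psi>, 0, 1/2)"

definition mu_of_loop ::
  "'a::topological_space set \<Rightarrow> ('a set \<times> ('a \<Rightarrow> real^2)) set \<Rightarrow> (real \<Rightarrow> 'a) \<Rightarrow>
     'a chord_diagram set \<Rightarrow>\<^sub>0 int" where
  "mu_of_loop F A a =
     (\<Sum>p\<in>essential_self_intersections F a.
        frag_of (chord_class F (bullet (first_loop A a p) (second_loop A a p)))
        - frag_of (chord_class F (bullet (second_loop A a p) (first_loop A a p))))"

definition mu_class where
  "mu_class F A \<alpha> =
     (if \<exists>a\<in>\<alpha>. general_position A a
      then mu_of_loop F A (generic_representative A \<alpha>) else 0)"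

definition mu where
  "mu F A = frag_extend (mu_class F A)"

text \<open>Smoothing at the chord cuts the core circle into the arc from head to tail and the arc from
  tail to head, in this order: for \<open>bullet \<phi> \<psi>\<close> these carry \<open>\<phi>\<close> and \<open>\<psi>\<close>. The tensor depends only on the
  homotopy class of the diagram.\<close>

definition smoothed_tensor where
  "smoothed_tensor F D =
     (case D of (f, h, t) \<Rightarrow> class_tensor F (arc_loop f h t) (arc_loop f t h))"

definition smoothing where
  "smoothing F =
     linear_extension (loop_tensor F) (\<lambda>C. the_elem (smoothed_tensor F ` C))"

end

theory Submission
  imports Defs
begin

text \<open>Both sides are linear and the two sums run over the same self-intersections, so it suffices that
  smoothing \<open>bullet \<phi> \<psi>\<close> returns the classes of \<open>\<phi>\<close> and \<open>\<psi>\<close>. The substance is that smoothing is well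
  defined on chord classes: a homotopy through chord diagrams restricts to homotopies of the two arcs
  as loops, and an orientation-preserving homeomorphism of the circle only reparametrizes these
  arcs.\<close>

section \<open>Loops on the circle, their periodic lifts and their arcs\<close>

text \<open>The jump of \<open>frac\<close> at an integer is invisible to \<open>k\<close>, whose
  values at 0 and 1 agree. The parameter space \<open>T\<close> is a point for a single loop and
  \<open>{0..1}\<close> for a homotopy. Two periods suffice for arcs, which start in
  \<open>{0..<1}\<close> and have length below 1.\<close>

lemma continuous_on_frac_closed_paths:
  fixes k :: "'b::topological_space \<times> real \<Rightarrow> 'a::topological_space"
  assumes "continuous_on (T \<times> {0..1}) k" and "\<And>u. u \<in> T \<Longrightarrow> k (u, 1) = k (u, 0)"
  shows "continuous_on (T \<times> {0..2}) (\<lambda>z. k (fst z, frac (snd z)))"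
proof -
  have "continuous_on (T \<times> {0..2})
          (\<lambda>z. if snd z \<le> 1 then k z else k (fst z, snd z - 1))"
  proof (rule continuous_on_cases_le)
    show "continuous_on {z \<in> T \<times> {0..2}. snd z \<le> 1} k"
      by (rule continuous_on_subset[OF assms(1)]) auto
    show "continuous_on {z \<in> T \<times> {0..2}. 1 \<le> snd z} (\<lambda>z. k (fst z, snd z - 1))"
      by (rule continuous_on_compose2[OF assms(1)]) (auto intro!: continuous_intros)
  qed (use assms(2) in \<open>auto intro!: continuous_intros\<close>)
  then show ?thesis
  proof (rule continuous_on_eq)
    fix z assume z: "z \<in> T \<times> {0..(2::real)}"
    \<comment> \<open>The point 2 is a case of its own: there \<open>snd z - 1\<close> is 1 but
      \<open>frac\<close> gives 0, so closedness is used again, as at 1.\<close>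
    have "frac (snd z) = (if snd z < 1 then snd z else if snd z < 2 then snd z - 1 else 0)"
      using z by (auto simp: frac_unique_iff)
    then show "(if snd z \<le> 1 then k z else k (fst z, snd z - 1)) = k (fst z, frac (snd z))"
      using z assms(2) by (cases z) auto
  qed
qed

lemma circle_map_add_int [simp]: "circle_map a (x + of_int n) = circle_map a x"
  and circle_map_diff_int [simp]: "circle_map a (x - of_int n) = circle_map a x"
  and circle_map_frac [simp]: "circle_map a (frac x) = circle_map a x"
  by (simp_all add: circle_map_def frac_def)

lemma circle_map_eq: "x \<in> {0..<1} \<Longrightarrow> circle_map a x = a x"
  by (simp add: circle_map_def frac_eq)

lemma circle_map_eq_closed:
  assumes "x \<in> {0..1}" and "pathfinish a = pathstart a"
  shows "circle_map a x = a x"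
  using assms by (cases "x = 1") (auto simp: circle_map_def pathstart_def pathfinish_def frac_eq)

lemma continuous_on_circle_map:
  assumes "path a" and "pathfinish a = pathstart a"
  shows "continuous_on UNIV (circle_map a)"
proof -
  have "continuous_on ({0::real} \<times> {0..2}) (\<lambda>z. (a \<circ> snd) (fst z, frac (snd z)))"
  proof (rule continuous_on_frac_closed_paths)
    show "continuous_on ({0::real} \<times> {0..1}) (a \<circ> snd)"
      using assms(1) unfolding path_def o_def
      by (rule continuous_on_compose2) (auto intro!: continuous_intros)
  qed (use assms(2) in \<open>simp add: pathstart_def pathfinish_def\<close>)
  then have "continuous_on {0..2} ((\<lambda>z. (a \<circ> snd) (fst z, frac (snd z))) \<circ> Pair (0::real))"
    by (intro continuous_on_o_Pair[where T = "{0}"]) simp_all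
  then have *: "continuous_on {0..2} (circle_map a)"
    by (simp add: circle_map_def o_def)
  have "isCont (circle_map a) t" for t
  proof -
    \<comment> \<open>With this \<open>n\<close>, \<open>t\<close> lies strictly between
      \<open>n\<close> and \<open>n + 2\<close>, also when \<open>t\<close> is an integer, so
      continuity on two periods gives continuity at \<open>t\<close>.\<close>
    define n where "n = \<lceil>t\<rceil> - 1"
    have "continuous_on {of_int n<..<of_int n + 2} (\<lambda>y. circle_map a (y - of_int n))"
      by (rule continuous_on_compose2[OF *]) (auto intro!: continuous_intros)
    moreover have "t \<in> {of_int n<..<of_int n + 2}"
      unfolding n_def by (simp; linarith)
    ultimately show ?thesis
      by (simp add: continuous_on_eq_continuous_at)
  qed
  then show ?thesis
    by (simp add: continuous_on_eq_continuous_at)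
qed

lemma circle_map_in:
  assumes "a \<in> free_loops F"
  shows "circle_map a x \<in> F"
proof -
  have "frac x \<in> {0..1}"
    using frac_ge_0 frac_lt_1[of x] by (simp add: less_imp_le)
  then show ?thesis
    using assms by (auto simp: free_loops_def path_image_def circle_map_def)
qed

lemma free_loops_circle_map:
  assumes "a \<in> free_loops F"
  shows "continuous_on UNIV (circle_map a)"
  using assms by (simp add: free_loops_def continuous_on_circle_map)

lemma circle_map_arc_end [simp]: "circle_map a (s + frac (t - s)) = circle_map a t"
proof -
  have "s + frac (t - s) = t - of_int \<lfloor>t - s\<rfloor>"
    by (simp add: frac_def)
  then show ?thesis
    by simp
qed

lemma arc_loop_0 [simp]: "arc_loop a s t 0 = circle_map a s"
  and arc_loop_1 [simp]: "arc_loop a s t 1 = circle_map a t"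
  by (simp_all add: arc_loop_def)

lemma arc_loop_free_loops:
  assumes "a \<in> free_loops F" and "circle_map a s = circle_map a t"
  shows "arc_loop a s t \<in> free_loops F"
proof -
  have "path (arc_loop a s t)"
    unfolding path_def arc_loop_def
    by (rule continuous_on_compose2[OF free_loops_circle_map[OF assms(1)]])
       (auto intro!: continuous_intros)
  then show ?thesis
    using assms
    by (auto simp: free_loops_def path_image_def pathstart_def pathfinish_def)
       (auto simp: arc_loop_def intro!: circle_map_in[OF assms(1)])
qed

section \<open>Homotopy invariance of the arcs\<close>

text \<open>Each stage of the homotopy takes equal values at \<open>h\<close> and \<open>t\<close>,
  so its restriction to the arc is again a loop. The condition \<open>P\<close> is kept abstract so
  that one homotopy can be used with \<open>h\<close> and \<open>t\<close> in either order, that is,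
  for both arcs.\<close>

lemma homotopic_loops_arc_loop:
  fixes f g :: "real \<Rightarrow> 'a::topological_space"
  assumes hom: "homotopic_with_canon P {0..1} F f g"
    and P: "\<And>r. P r \<Longrightarrow> pathfinish r = pathstart r \<and> r h = r t"
    and h: "h \<in> {0..<1}" and t: "t \<in> {0..<1}"
  shows "homotopic_loops F (arc_loop f h t) (arc_loop g h t)"
proof -
  obtain k :: "real \<times> real \<Rightarrow> 'a" where k: "continuous_on ({0..1} \<times> {0..1}) k" "k \<in> ({0..1} \<times> {0..1}) \<rightarrow> F"
      "\<And>x. k (0, x) = f x" "\<And>x. k (1, x) = g x" "\<And>u. u \<in> {0..1} \<Longrightarrow> P (\<lambda>x. k (u, x))"
    using hom unfolding homotopic_with_def
    by (clarsimp simp: image_subset_iff_funcset)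
  have ends: "k (u, 1) = k (u, 0)" "k (u, h) = k (u, t)" if "u \<in> {0..1}" for u
    using P[OF k(5)[OF that]] by (auto simp: pathstart_def pathfinish_def)
  let ?d = "frac (t - h)"
  define K where "K = (\<lambda>z. k (fst z, frac (h + snd z * ?d)))"
  have arc: "K (u, x) = arc_loop (\<lambda>y. k (u, y)) h t x" for u x
    by (simp add: K_def arc_loop_def circle_map_def)
  have d: "0 \<le> ?d" "?d < 1"
    by (simp_all add: frac_lt_1)
  \<comment> \<open>The start is below 1 and the length is below 1, so the arc stays inside the two
    periods on which continuity is known.\<close>
  have range: "h + x * ?d \<in> {0..2}" if "x \<in> {0..1}" for x
    using that h d mult_mono[of x 1 ?d 1] by auto
  have "continuous_on ({0..1} \<times> {0..2}) (\<lambda>z. k (fst z, frac (snd z)))"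
    using k(1) ends(1) by (rule continuous_on_frac_closed_paths)
  then have "continuous_on ({0..1} \<times> {0..1})
      ((\<lambda>z. k (fst z, frac (snd z))) \<circ> (\<lambda>z. (fst z, h + snd z * ?d)))"
    using range
    by (intro continuous_on_compose continuous_intros)
       (auto elim!: continuous_on_subset)
  then have "continuous_on ({0..1} \<times> {0..1}) K"
    by (simp add: K_def o_def)
  moreover have "K \<in> ({0..1} \<times> {0..1}) \<rightarrow> F"
    using k(2) by (auto simp: K_def Pi_iff less_imp_le[OF frac_lt_1])
  moreover have "pathfinish (\<lambda>x. K (u, x)) = pathstart (\<lambda>x. K (u, x))" if "u \<in> {0..1}" for u
    using ends(2)[OF that] h t by (simp add: arc pathstart_def pathfinish_def circle_map_eq)
  moreover have "K (0, x) = arc_loop f h t x" "K (1, x) = arc_loop g h t x" for x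
    by (simp_all add: arc k(3,4))
  ultimately show ?thesis
    unfolding homotopic_loops by (intro exI[of _ K]) (simp add: o_def)
qed

section \<open>Reparametrization by homeomorphisms of the circle\<close>

lemma circle_homeo_lift_add_nat:
  assumes "circle_homeo_lift \<theta>"
  shows "\<theta> (x + of_nat n) = \<theta> x + of_nat n"
proof (induction n)
  case (Suc n)
  have "\<theta> (x + of_nat n + 1) = \<theta> (x + of_nat n) + 1"
    using assms by (simp only: circle_homeo_lift_def)
  then show ?case
    using Suc by (simp add: add_ac)
qed simp

lemma circle_homeo_lift_add_int:
  assumes "circle_homeo_lift \<theta>"
  shows "\<theta> (x + of_int m) = \<theta> x + of_int m"
proof (cases m)
  case (nonneg n)
  then show ?thesis
    using circle_homeo_lift_add_nat[OF assms, of x n] by simp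
next
  case (neg n)
  \<comment> \<open>Here \<open>m\<close> is \<open>- Suc n\<close>, so shifting
    \<open>x + m\<close> by \<open>Suc n\<close> leads back to \<open>x\<close>.\<close>
  then show ?thesis
    using circle_homeo_lift_add_nat[OF assms, of "x + of_int m" "Suc n"]
    by (simp add: neg algebra_simps)
qed

text \<open>Since \<theta> commutes with integer translations,
  \<open>circle_map f \<circ> \<theta>\<close> already has period 1, and the outer
  \<open>circle_map\<close> changes nothing.\<close>

lemma circle_map_circle_homeo_lift:
  assumes "circle_homeo_lift \<theta>"
  shows "circle_map (circle_map f \<circ> \<theta>) x = circle_map f (\<theta> x)"
proof -
  have "\<theta> x = \<theta> (frac x) + of_int \<lfloor>x\<rfloor>"
    using circle_homeo_lift_add_int[OF assms, of "frac x" "\<lfloor>x\<rfloor>"] by (simp add: frac_def)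
  then have "circle_map f (\<theta> x) = circle_map f (\<theta> (frac x))"
    by simp
  then show ?thesis
    by (simp add: circle_map_def[of "circle_map f \<circ> \<theta>"])
qed

text \<open>Both arcs are images under \<open>circle_map f\<close> of paths in \<open>\<real>\<close> with the same end points.\<close>

lemma homotopic_loops_arc_loop_circle_homeo:
  assumes f: "f \<in> free_loops F" and \<theta>: "circle_homeo_lift \<theta>"
    and h: "h \<in> {0..<1}" and t: "t \<in> {0..<1}" and "h \<noteq> t"
    and eq: "circle_map f (\<theta> h) = circle_map f (\<theta> t)"
  shows "homotopic_loops F (arc_loop (circle_map f \<circ> \<theta>) h t) (arc_loop f (frac (\<theta> h)) (frac (\<theta> t)))"
proof -
  let ?d = "frac (t - h)" and ?h = "frac (\<theta> h)" and ?t = "frac (\<theta> t)"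
  have cont: "continuous_on UNIV \<theta>" and mono: "strict_mono \<theta>"
    using \<theta> by (auto simp: circle_homeo_lift_def)
  \<comment> \<open>Distinct representatives in \<open>{0..<1}\<close> never differ by an integer;
    hence the arc has positive length.\<close>
  have "t - h \<notin> \<int>"
  proof
    assume "t - h \<in> \<int>"
    then obtain m where "t - h = of_int m" by (auto elim: Ints_cases)
    moreover have "-1 < t - h" "t - h < 1" "t - h \<noteq> 0"
      using h t \<open>h \<noteq> t\<close> by auto
    ultimately show False by simp
  qed
  then have d: "0 < ?d" "?d < 1"
    by (simp_all add: frac_gt_0_iff frac_lt_1)
  have end_eq: "\<theta> (h + ?d) = \<theta> t - of_int \<lfloor>t - h\<rfloor>"
    using circle_homeo_lift_add_int[OF \<theta>, of t "- \<lfloor>t - h\<rfloor>"] by (simp add: frac_def)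
  \<comment> \<open>Monotonicity and the translation rule put the length of the image arc strictly
    between 0 and 1. It differs from \<open>?t - ?h\<close> by an integer, so it is the fractional
    part of that difference.\<close>
  have "\<theta> h < \<theta> (h + ?d)" "\<theta> (h + ?d) < \<theta> (h + 1)"
    using d mono by (simp_all only: strict_mono_less)
  moreover have "\<theta> (h + 1) = \<theta> h + 1"
    using \<theta> by (simp add: circle_homeo_lift_def)
  moreover have "\<theta> (h + ?d) - \<theta> h - (?t - ?h) = of_int (\<lfloor>\<theta> t\<rfloor> - \<lfloor>t - h\<rfloor> - \<lfloor>\<theta> h\<rfloor>)"
    unfolding end_eq by (simp add: frac_def)
  then have "(?t - ?h) - (\<theta> (h + ?d) - \<theta> h) \<in> \<int>"
    by (metis Ints_minus Ints_of_int minus_diff_eq)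
  ultimately have len: "frac (?t - ?h) = \<theta> (h + ?d) - \<theta> h"
    by (simp add: frac_unique_iff)
  \<comment> \<open>Subtracting the integer makes \<open>p\<close> start at \<open>?h\<close>, like
    the affine path \<open>q\<close>; \<open>circle_map f\<close> does not see the shift. The end
    points agree by \<open>len\<close>, and the line is convex, so the straight-line homotopy
    applies.\<close>
  define p where "p = (\<lambda>x. \<theta> (h + x * ?d) - of_int \<lfloor>\<theta> h\<rfloor>)"
  define q where "q = (\<lambda>x. ?h + x * frac (?t - ?h))"
  have "homotopic_paths UNIV p q"
  proof (rule homotopic_paths_linear)
    show "path p"
      unfolding p_def path_def
      by (intro continuous_on_diff continuous_on_const continuous_on_compose2[OF cont])
         (auto intro!: continuous_intros)
    show "path q"
      unfolding q_def path_def by (intro continuous_intros)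
    show "pathstart q = pathstart p"
      by (simp add: p_def q_def pathstart_def frac_def)
    show "pathfinish q = pathfinish p"
      unfolding p_def q_def pathfinish_def len by (simp add: frac_def)
  qed auto
  then have "homotopic_paths F (circle_map f \<circ> p) (circle_map f \<circ> q)"
    by (rule homotopic_paths_continuous_image[OF _ free_loops_circle_map[OF f]])
       (auto intro: circle_map_in[OF f])
  moreover have "circle_map f \<circ> p = arc_loop (circle_map f \<circ> \<theta>) h t"
    by (simp add: fun_eq_iff p_def arc_loop_def circle_map_circle_homeo_lift[OF \<theta>])
  moreover have "circle_map f \<circ> q = arc_loop f ?h ?t"
    by (simp add: fun_eq_iff q_def arc_loop_def)
  ultimately show ?thesis
    using eq
    by (intro homotopic_paths_imp_homotopic_loops)
       (simp_all add: pathstart_def pathfinish_def circle_map_circle_homeo_lift[OF \<theta>])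
qed

section \<open>Smoothing on homotopy classes of chord diagrams\<close>

lemma free_class_eqI: "homotopic_loops F a b \<Longrightarrow> free_class F a = free_class F b"
  unfolding free_class_def by (blast intro: homotopic_loops_trans homotopic_loops_sym)

text \<open>Each tensor factor is followed first along the homotopy to
  \<open>circle_map f' \<circ> \<theta>\<close> and then along the reparametrization by \<theta>;
  exchanging \<open>h\<close> and \<open>t\<close> treats the other factor.\<close>

lemma chord_homotopic_smoothed_tensor:
  assumes "chord_homotopic F D D'"
  shows "smoothed_tensor F D' = smoothed_tensor F D"
proof -
  obtain f h t f' h' t' where D: "D = (f, h, t)" "D' = (f', h', t')"
    by (metis prod.exhaust)
  obtain \<theta> where \<theta>: "circle_homeo_lift \<theta>" and fr: "frac (\<theta> h) = h'" "frac (\<theta> t) = t'"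
    and hom: "homotopic_with_canon (\<lambda>r. pathfinish r = pathstart r \<and> r h = r t) {0..1} F
              f (circle_map f' \<circ> \<theta>)"
    using assms by (auto simp: chord_homotopic_def D)
  have ht: "h \<in> {0..<1}" "t \<in> {0..<1}" "h \<noteq> t" and f': "f' \<in> free_loops F" and "f' h' = f' t'"
    using assms by (auto simp: chord_homotopic_def D chord_diagrams_def)
  then have eq: "circle_map f' (\<theta> h) = circle_map f' (\<theta> t)"
    by (simp add: circle_map_def fr)
  have "free_class F (arc_loop f h t) = free_class F (arc_loop f' h' t')"
    unfolding fr[symmetric]
    by (intro free_class_eqI homotopic_loops_trans[OF homotopic_loops_arc_loop[OF hom]
          homotopic_loops_arc_loop_circle_homeo[OF f' \<theta>]]) (use ht eq in auto)
  moreover have "free_class F (arc_loop f t h) = free_class F (arc_loop f' t' h')"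
    unfolding fr[symmetric]
    by (intro free_class_eqI homotopic_loops_trans[OF homotopic_loops_arc_loop[OF hom]
          homotopic_loops_arc_loop_circle_homeo[OF f' \<theta>]]) (use ht eq in auto)
  ultimately show ?thesis
    by (simp add: D smoothed_tensor_def class_tensor_def)
qed

text \<open>For \<theta> the identity the target map is \<open>circle_map f\<close>, which agrees
  with \<open>f\<close> on \<open>{0..1}\<close> but perhaps not elsewhere; the homotopy comes from
  this agreement. It ensures that the class of a diagram contains the diagram.\<close>

lemma chord_homotopic_refl:
  assumes "D \<in> chord_diagrams F"
  shows "chord_homotopic F D D"
proof -
  obtain f h t where D: "D = (f, h, t)"
    by (metis prod.exhaust)
  have f: "f \<in> free_loops F" and ht: "h \<in> {0..<1}" "t \<in> {0..<1}" "f h = f t"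
    using assms by (auto simp: D chord_diagrams_def)
  have loop: "path f" "path_image f \<subseteq> F" "pathfinish f = pathstart f"
    using f by (auto simp: free_loops_def)
  have "homotopic_with_canon (\<lambda>r. pathfinish r = pathstart r \<and> r h = r t) {0..1} F f (circle_map f)"
  proof (rule homotopic_with_equal)
    show "continuous_map (top_of_set {0..1}) (top_of_set F) f"
      using loop by (auto simp: path_def path_image_def)
  qed (use loop ht in \<open>auto simp: circle_map_eq_closed circle_map_eq pathstart_def pathfinish_def\<close>)
  moreover have "circle_homeo_lift id"
    by (simp add: circle_homeo_lift_def strict_mono_def continuous_on_id)
  ultimately show ?thesis
    using assms ht by (auto simp: chord_homotopic_def D frac_eq intro!: exI[of _ id])
qed

text \<open>The smoothed tensor is constant on the class by homotopy invariance, and the class is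
  nonempty by reflexivity, so the image is a singleton.\<close>

lemma the_elem_smoothed_tensor_chord_class:
  assumes "D \<in> chord_diagrams F"
  shows "the_elem (smoothed_tensor F ` chord_class F D) = smoothed_tensor F D"
proof -
  have "smoothed_tensor F ` chord_class F D = {smoothed_tensor F D}"
  proof (intro equalityI subsetI; elim imageE singletonE)
    fix T D' assume "T = smoothed_tensor F D'" "D' \<in> chord_class F D"
    then show "T \<in> {smoothed_tensor F D}"
      by (simp add: chord_class_def chord_homotopic_smoothed_tensor)
  next
    fix T assume "T = smoothed_tensor F D"
    then show "T \<in> smoothed_tensor F ` chord_class F D"
      using chord_homotopic_refl[OF assms] by (auto simp: chord_class_def)
  qed
  then show ?thesis
    by simp
qed

lemma bullet_chord_diagrams:
  assumes "\<phi> \<in> free_loops F" "\<psi> \<in> free_loops F" "pathstart \<phi> = pathstart \<psi>"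
  shows "bullet \<phi> \<psi> \<in> chord_diagrams F"
  using assms
  by (auto simp: bullet_def chord_diagrams_def free_loops_def path_image_join)
     (auto simp: joinpaths_def pathstart_def pathfinish_def)

text \<open>The chord splits the circle into two halves of length 1/2; rescaling each half to
  \<open>{0..1}\<close> undoes the reparametrization made by \<open>+++\<close>.\<close>

lemma smoothed_tensor_bullet:
  assumes "\<phi> \<in> free_loops F" "\<psi> \<in> free_loops F" "pathstart \<phi> = pathstart \<psi>"
  shows "smoothed_tensor F (bullet \<phi> \<psi>) = class_tensor F \<phi> \<psi>"
proof -
  have [simp]: "\<phi> 1 = \<phi> 0" "\<psi> 0 = \<phi> 0" "\<psi> 1 = \<phi> 0"
    using assms by (auto simp: free_loops_def pathstart_def pathfinish_def)
  have half: "frac (1/2 :: real) = 1/2" "frac (-(1/2) :: real) = 1/2"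
    by (simp_all add: frac_def)
  have "\<phi> x = arc_loop (\<phi> +++ \<psi>) 0 (1/2) x" if "x \<in> {0..1}" for x
    using that by (simp add: arc_loop_def half circle_map_def joinpaths_def frac_eq)
  then have "free_class F \<phi> = free_class F (arc_loop (\<phi> +++ \<psi>) 0 (1/2))"
    using assms(1) by (intro free_class_eqI homotopic_loops_eq) (auto simp: free_loops_def)
  moreover have "\<psi> x = arc_loop (\<phi> +++ \<psi>) (1/2) 0 x" if "x \<in> {0..1}" for x
  \<comment> \<open>At both ends the value is read off \<phi> instead of \<psi>: 1/2 belongs to the
    first branch of \<open>+++\<close>, and 1 is reduced to 0. All these values are the common base
    point.\<close>
  proof (cases "x = 0 \<or> x = 1")
    case True
    then show ?thesis
      by (auto simp: circle_map_def joinpaths_def half)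
  next
    case False
    then have "frac (1/2 + x * (1/2)) = 1/2 + x * (1/2)"
      using that by (simp add: frac_eq)
    then show ?thesis
      using that False by (simp add: arc_loop_def half circle_map_def joinpaths_def)
  qed
  then have "free_class F \<psi> = free_class F (arc_loop (\<phi> +++ \<psi>) (1/2) 0)"
    using assms(2) by (intro free_class_eqI homotopic_loops_eq) (auto simp: free_loops_def)
  ultimately show ?thesis
    by (simp add: bullet_def smoothed_tensor_def class_tensor_def)
qed

section \<open>Linear maps out of free abelian groups\<close>

text \<open>Basis elements outside the support have exponent 0 and contribute the neutral element.
  This allows a common index set for \<open>x\<close>, \<open>y\<close> and \<open>x + y\<close>,
  whose support may shrink by cancellation.\<close>

lemma (in comm_group) linear_extension_superset:
  assumes "finite K" "Poly_Mapping.keys x \<subseteq> K" "b \<in> K \<rightarrow> carrier G"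
  shows "linear_extension G b x = finprod G (\<lambda>i. b i [^] Poly_Mapping.lookup x i) K"
  unfolding linear_extension_def
  by (rule finprod_mono_neutral_cong_left) (use assms in \<open>auto simp: in_keys_iff\<close>)

lemma (in comm_group) linear_extension_hom:
  assumes b: "b \<in> S \<rightarrow> carrier G"
  shows "linear_extension G b \<in> hom (free_Abelian_group S) G"
proof (rule homI)
  fix x assume x: "x \<in> carrier (free_Abelian_group S)"
  then show "linear_extension G b x \<in> carrier G"
    using b unfolding linear_extension_def by (intro finprod_closed) auto
  fix y assume y: "y \<in> carrier (free_Abelian_group S)"
  let ?K = "Poly_Mapping.keys x \<union> Poly_Mapping.keys y"
  have bK: "b \<in> ?K \<rightarrow> carrier G"
    using x y b by auto
  have "linear_extension G b (x + y) = finprod G (\<lambda>i. b i [^] Poly_Mapping.lookup (x + y) i) ?K"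
    by (rule linear_extension_superset) (use bK keys_add[of x y] in auto)
  also have "\<dots> = finprod G (\<lambda>i. b i [^] Poly_Mapping.lookup x i \<otimes> b i [^] Poly_Mapping.lookup y i) ?K"
    by (rule finprod_cong') (use bK in \<open>auto simp: lookup_add int_pow_mult Pi_iff\<close>)
  also have "\<dots> = finprod G (\<lambda>i. b i [^] Poly_Mapping.lookup x i) ?K
      \<otimes> finprod G (\<lambda>i. b i [^] Poly_Mapping.lookup y i) ?K"
    by (rule finprod_multf) (use bK in auto)
  also have "\<dots> = linear_extension G b x \<otimes> linear_extension G b y"
    using bK by (simp add: linear_extension_superset[of ?K])
  finally show "linear_extension G b (x \<otimes>\<^bsub>free_Abelian_group S\<^esub> y)
      = linear_extension G b x \<otimes> linear_extension G b y"
    by simp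
qed

lemma (in comm_group) linear_extension_frag_of:
  assumes "b i \<in> carrier G"
  shows "linear_extension G b (frag_of i) = b i"
  using assms by (simp add: linear_extension_def)

text \<open>For infinite \<open>I\<close> the sum is 0 and the product is \<one> by convention, and
  \<open>h\<close> carries 0 to \<one>; the identity thus holds for every index set.\<close>

lemma (in comm_group) hom_free_Abelian_group_sum:
  assumes "h \<in> hom (free_Abelian_group S) G" and "\<And>i. i \<in> I \<Longrightarrow> Poly_Mapping.keys (f i) \<subseteq> S"
  shows "h (sum f I) = finprod G (\<lambda>i. h (f i)) I"
proof -
  interpret group_hom "free_Abelian_group S" G h
    using assms(1) by (intro group_hom.intro group_hom_axioms.intro) simp_all
  have closed: "h (f i) \<in> carrier G" if "i \<in> I" for i
    using assms(2)[OF that] by simp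
  have h0: "h 0 = \<one>"
    using hom_one by simp
  show ?thesis
    using assms(2) closed
  proof (induction I rule: infinite_finite_induct)
    case (insert i I)
    have "Poly_Mapping.keys (sum f I) \<subseteq> S"
      using insert by (intro order_trans[OF keys_sum]) auto
    then have "h (f i + sum f I) = h (f i) \<otimes> h (sum f I)"
      using insert.prems hom_mult[of "f i" "sum f I"] by simp
    then show ?case
      using insert by (subst finprod_insert) auto
  qed (simp_all add: h0)
qed

text \<open>This reduces the factorization to basis elements: it is applied with smoothing as
  \<open>h\<close> and \<open>mu_class\<close> as \<open>g\<close>.\<close>

lemma (in comm_group) hom_frag_extend:
  assumes h: "h \<in> hom (free_Abelian_group S) G"
    and g: "\<And>i. i \<in> Poly_Mapping.keys x \<Longrightarrow> Poly_Mapping.keys (g i) \<subseteq> S"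
  shows "h (frag_extend g x) = linear_extension G (\<lambda>i. h (g i)) x"
proof -
  interpret group_hom "free_Abelian_group S" G h
    using h by (intro group_hom.intro group_hom_axioms.intro) simp_all
  have pow: "h (frag_cmul c (g i)) = h (g i) [^] c" if "i \<in> Poly_Mapping.keys x" for c i
    using hom_int_pow[of "g i" c] g[OF that] by simp
  have closed: "h (g i) \<in> carrier G" if "i \<in> Poly_Mapping.keys x" for i
    using g[OF that] by simp
  show ?thesis
    unfolding frag_extend_def linear_extension_def
    by (subst hom_free_Abelian_group_sum[OF h])
       (use g keys_cmul closed in \<open>auto simp: pow intro!: finprod_cong'\<close>)
qed

section \<open>Tensor products and the tensors of loop classes\<close>

text \<open>Closure of both carriers under multiplication keeps the bilinearity relations inside the
  free abelian group, so they generate a subgroup by which it can be divided.\<close>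

lemma tensor_subgroup:
  assumes "group G" "group H"
  shows "subgroup (tensor_subgroup G H) (free_Abelian_group (carrier G \<times> carrier H))"
proof -
  interpret G: group G by fact
  interpret H: group H by fact
  let ?S = "carrier G \<times> carrier H"
  have diff: "Poly_Mapping.keys (frag_of a - frag_of b - frag_of c) \<subseteq> ?S"
    if "a \<in> ?S" "b \<in> ?S" "c \<in> ?S" for a b c
    using that keys_diff[of "frag_of a - frag_of b" "frag_of c"] keys_diff[of "frag_of a" "frag_of b"]
    by (auto simp: subset_iff)
  have "tensor_relations G H \<subseteq> carrier (free_Abelian_group ?S)"
    unfolding tensor_relations_def
    by (rule subsetI, elim UnE CollectE exE conjE; hypsubst; unfold carrier_free_Abelian_group_iff)
       (rule diff; simp)+
  then show ?thesis
    unfolding tensor_subgroup_def by (rule group.generate_is_subgroup[OF group_free_Abelian_group])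
qed

lemma comm_group_tensor_product:
  assumes "group G" "group H"
  shows "comm_group (tensor_product G H)"
  unfolding tensor_product_def
  by (intro comm_group.abelian_FactGroup abelian_free_Abelian_group tensor_subgroup assms)

lemma elementary_tensor_closed:
  assumes "x \<in> carrier G" "y \<in> carrier H"
  shows "elementary_tensor G H x y \<in> carrier (tensor_product G H)"
  using assms
  by (auto simp: elementary_tensor_def tensor_product_def FactGroup_def RCOSETS_def)

lemma comm_group_loop_tensor: "comm_group (loop_tensor F)"
  by (simp add: comm_group_tensor_product)

lemma class_tensor_closed:
  assumes "a \<in> free_loops F" "b \<in> free_loops F"
  shows "class_tensor F a b \<in> carrier (loop_tensor F)"
  unfolding class_tensor_def
  by (rule elementary_tensor_closed) (use assms in \<open>auto simp: pi_hat_def\<close>)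

lemma smoothed_tensor_closed:
  assumes "D \<in> chord_diagrams F"
  shows "smoothed_tensor F D \<in> carrier (loop_tensor F)"
proof -
  obtain f h t where D: "D = (f, h, t)" "f \<in> free_loops F" "h \<in> {0..<1}" "t \<in> {0..<1}" "f h = f t"
    using assms by (auto simp: chord_diagrams_def)
  then have "circle_map f h = circle_map f t"
    by (simp add: circle_map_eq)
  then show ?thesis
    using D by (simp add: smoothed_tensor_def class_tensor_closed arc_loop_free_loops)
qed

section \<open>Smoothing as a homomorphism, and its values on \<mu>\<close>

lemma smoothing_hom: "smoothing F \<in> hom (chord_module F) (loop_tensor F)"
  unfolding smoothing_def
  by (rule comm_group.linear_extension_hom[OF comm_group_loop_tensor])
     (auto simp: the_elem_smoothed_tensor_chord_class smoothed_tensor_closed)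

lemma smoothing_chord_class:
  assumes "D \<in> chord_diagrams F"
  shows "smoothing F (frag_of (chord_class F D)) = smoothed_tensor F D"
  using assms unfolding smoothing_def
  by (subst comm_group.linear_extension_frag_of[OF comm_group_loop_tensor])
     (simp_all add: the_elem_smoothed_tensor_chord_class smoothed_tensor_closed)

lemma smoothing_bullet:
  assumes "\<phi> \<in> free_loops F" "\<psi> \<in> free_loops F" "pathstart \<phi> = pathstart \<psi>"
  shows "smoothing F (frag_of (chord_class F (bullet \<phi> \<psi>))) = class_tensor F \<phi> \<psi>"
  using assms by (simp add: smoothing_chord_class bullet_chord_diagrams smoothed_tensor_bullet)

text \<open>Whatever the sign at the crossing, the two loops are the two arcs there, and both start
  at the double point.\<close>

lemma first_second_loop:
  assumes "a \<in> free_loops F" "p \<in> self_intersections a"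
  shows "first_loop A a p \<in> free_loops F" "second_loop A a p \<in> free_loops F"
    and "pathstart (first_loop A a p) = pathstart (second_loop A a p)"
proof -
  obtain s t where p: "p = (s, t)" "s \<in> {0..<1}" "t \<in> {0..<1}" "a s = a t"
    using assms(2) by (auto simp: self_intersections_def)
  then have eq: "circle_map a s = circle_map a t"
    by (simp add: circle_map_eq)
  then show "first_loop A a p \<in> free_loops F" "second_loop A a p \<in> free_loops F"
      "pathstart (first_loop A a p) = pathstart (second_loop A a p)"
    using arc_loop_free_loops[OF assms(1)]
    by (auto simp: p(1) first_loop_def second_loop_def pathstart_def)
qed

text \<open>The comparison is made crossing by crossing. The bound on the keys lets the homomorphism
  property of smoothing be applied to \<mu>.\<close>

lemma
  assumes a: "a \<in> free_loops F"
  shows keys_mu_of_loop: "Poly_Mapping.keys (mu_of_loop F A a) \<subseteq> chord_class F ` chord_diagrams F"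
    and smoothing_mu_of_loop: "smoothing F (mu_of_loop F A a) = cobracket_of_loop F A a"
proof -
  interpret T: comm_group "loop_tensor F"
    by (rule comm_group_loop_tensor)
  interpret Q: group_hom "chord_module F" "loop_tensor F" "smoothing F"
    using smoothing_hom by (intro group_hom.intro group_hom_axioms.intro) simp_all
  let ?E = "essential_self_intersections F a" and ?S = "chord_class F ` chord_diagrams F"
  let ?u = "\<lambda>p. frag_of (chord_class F (bullet (first_loop A a p) (second_loop A a p)))"
  let ?v = "\<lambda>p. frag_of (chord_class F (bullet (second_loop A a p) (first_loop A a p)))"
  have loops: "first_loop A a p \<in> free_loops F" "second_loop A a p \<in> free_loops F"
      "pathstart (first_loop A a p) = pathstart (second_loop A a p)" if "p \<in> ?E" for p
    using that first_second_loop[OF a] by (auto simp: essential_self_intersections_def)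
  have keys: "Poly_Mapping.keys (?u p) \<subseteq> ?S" "Poly_Mapping.keys (?v p) \<subseteq> ?S" if "p \<in> ?E" for p
    using loops[OF that] by (auto intro!: imageI bullet_chord_diagrams)
  have keys_diff: "Poly_Mapping.keys (?u p - ?v p) \<subseteq> ?S" if "p \<in> ?E" for p
    using keys[OF that] by (intro order_trans[OF keys_diff]) auto
  show "Poly_Mapping.keys (mu_of_loop F A a) \<subseteq> ?S"
    unfolding mu_of_loop_def
    by (rule order_trans[OF keys_sum]) (use keys_diff in blast)
  have *: "smoothing F (?u p - ?v p)
      = class_tensor F (first_loop A a p) (second_loop A a p) \<otimes>\<^bsub>loop_tensor F\<^esub>
        inv\<^bsub>loop_tensor F\<^esub> class_tensor F (second_loop A a p) (first_loop A a p)" if "p \<in> ?E" for p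
  proof -
    \<comment> \<open>The chord module is additive and the tensor product multiplicative, so a
      difference becomes a product with an inverse.\<close>
    have "smoothing F (?u p - ?v p)
        = smoothing F (?u p) \<otimes>\<^bsub>loop_tensor F\<^esub> inv\<^bsub>loop_tensor F\<^esub> smoothing F (?v p)"
      using keys[OF that] Q.hom_mult[of "?u p" "- ?v p"] Q.hom_inv[of "?v p"] by simp
    then show ?thesis
      using loops[OF that] by (simp add: smoothing_bullet)
  qed
  have "smoothing F (mu_of_loop F A a)
      = finprod (loop_tensor F) (\<lambda>p. smoothing F (?u p - ?v p)) ?E"
    unfolding mu_of_loop_def by (rule T.hom_free_Abelian_group_sum[OF smoothing_hom keys_diff])
  also have "\<dots> = cobracket_of_loop F A a"
    unfolding cobracket_of_loop_def
    by (intro T.finprod_cong' refl * Pi_I T.m_closed T.inv_closed class_tensor_closed loops)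
  finally show "smoothing F (mu_of_loop F A a) = cobracket_of_loop F A a" .
qed

lemma pi_hat_memD:
  assumes "\<alpha> \<in> pi_hat F" "a \<in> \<alpha>"
  shows "a \<in> free_loops F"
proof -
  from assms obtain b where "homotopic_loops F b a"
    by (auto simp: pi_hat_def free_class_def)
  then show ?thesis
    by (simp add: free_loops_def homotopic_loops_imp_path[of F b a]
        homotopic_loops_imp_loop[of F b a] homotopic_loops_imp_subset[of F b a])
qed

lemma generic_representative_in:
  assumes "\<exists>a\<in>\<alpha>. general_position A a"
  shows "generic_representative A \<alpha> \<in> \<alpha>"
proof -
  have "\<exists>a. a \<in> \<alpha> \<and> general_position A a"
    using assms by blast
  then show ?thesis
    unfolding generic_representative_def by (rule someI2_ex) simp
qed

text \<open>Both operations use the same chosen representative of \<alpha> and the same case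
  distinction.\<close>

lemma
  assumes "\<alpha> \<in> pi_hat F"
  shows keys_mu_class: "Poly_Mapping.keys (mu_class F A \<alpha>) \<subseteq> chord_class F ` chord_diagrams F"
    and smoothing_mu_class: "smoothing F (mu_class F A \<alpha>) = cobracket_class F A \<alpha>"
proof -
  have gen: "generic_representative A \<alpha> \<in> free_loops F" if "\<exists>a\<in>\<alpha>. general_position A a"
    using assms generic_representative_in[OF that] by (rule pi_hat_memD)
  show "Poly_Mapping.keys (mu_class F A \<alpha>) \<subseteq> chord_class F ` chord_diagrams F"
    by (simp add: mu_class_def keys_mu_of_loop[OF gen])
  interpret T: comm_group "loop_tensor F"
    by (rule comm_group_loop_tensor)
  \<comment> \<open>Smoothing matches the two fallback values.\<close>
  have "smoothing F 0 = \<one>\<^bsub>loop_tensor F\<^esub>"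
    by (simp add: smoothing_def linear_extension_def)
  then show "smoothing F (mu_class F A \<alpha>) = cobracket_class F A \<alpha>"
    by (simp add: mu_class_def cobracket_class_def smoothing_mu_of_loop[OF gen])
qed

theorem mainTheorem3:
  fixes F :: "'a::topological_space set"
    and A :: "('a set \<times> ('a \<Rightarrow> real^2)) set"
  assumes "oriented_surface F A"
  shows "\<forall>x\<in>carrier (loop_module F). turaev_cobracket F A x = (smoothing F \<circ> mu F A) x"
proof
  fix x assume "x \<in> carrier (loop_module F)"
  then have pi: "\<alpha> \<in> pi_hat F" if "\<alpha> \<in> Poly_Mapping.keys x" for \<alpha>
    using that by auto
  interpret T: comm_group "loop_tensor F"
    by (rule comm_group_loop_tensor)
  interpret Q: group_hom "chord_module F" "loop_tensor F" "smoothing F"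
    using smoothing_hom by (intro group_hom.intro group_hom_axioms.intro) simp_all
  have closed: "smoothing F (mu_class F A \<alpha>) \<in> carrier (loop_tensor F)" if "\<alpha> \<in> Poly_Mapping.keys x" for \<alpha>
    using keys_mu_class[OF pi[OF that]] by simp
  \<comment> \<open>Smoothing moves inside the linear extension; only the values on the basis
    \<open>pi_hat F\<close> remain to be compared.\<close>
  have "smoothing F (mu F A x) = linear_extension (loop_tensor F) (\<lambda>\<alpha>. smoothing F (mu_class F A \<alpha>)) x"
    unfolding mu_def by (rule T.hom_frag_extend[OF smoothing_hom]) (rule keys_mu_class[OF pi])
  also have "\<dots> = turaev_cobracket F A x"
    unfolding turaev_cobracket_def linear_extension_def
    by (rule T.finprod_cong') (use closed in \<open>auto simp: smoothing_mu_class[OF pi, symmetric]\<close>)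
  finally show "turaev_cobracket F A x = (smoothing F \<circ> mu F A) x"
    by simp
qed

end
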